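(* Assume $\mathfrak{d} = \aleph_1$. Let $\mathcal{U}$ be any ultrafilter on $\omega$ and let $f : \omega \to \omega$ be such that $|f^{-1}(\{n\})| = \aleph_0$ for all $n \in \omega$. Then there exists an ultrafilter $\mathcal{V}$ on $\omega$ such that $\mathcal{V}$ is a Q-point and $f$ witnesses $\mathcal{U} \le_{RK} \mathcal{V}$, i.e. $\mathcal{U} = \{A \subseteq \omega : f^{-1}(A) \in \mathcal{V}\}$.
   Context: $\mathfrak{d}$ is the dominating number, the minimal cardinality of a dominating family in $\omega^\omega$. An ultrafilter $\mathcal{V}$ on $\omega$ is a Q-point if for every finite-to-one function $g:\omega\to\omega$ there is $A \in \mathcal{V}$ on which $g$ is one-to-one. $\mathcal{U} \le_{RK} \mathcal{V}$ (Rudin–Keisler) means there is $f:\omega\to\omega$ with $\mathcal{U} = \{A\subseteq\omega : f^{-1}(A)\in\mathcal{V}\}$; such $f$ is said to witness it. *)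

theory Defs
  imports Complex_Main
begin

unbundle cardinal_syntax

definition dominating_family :: "(nat \<Rightarrow> nat) set \<Rightarrow> bool" where
  "dominating_family D \<longleftrightarrow> (\<forall>g. \<exists>h\<in>D. \<forall>\<^sub>F n in sequentially. g n \<le> h n)"

text \<open>
  Cardinals are cardinal well-orders up to \<open>=o\<close>, so the minimal cardinality is determined
  only up to \<open>=o\<close> and should only be compared modulo it.
\<close>

definition dominating_number :: "(nat \<Rightarrow> nat) rel" where
  "dominating_number =
     (SOME r. \<exists>D. dominating_family D \<and> r = |D| \<and> (\<forall>E. dominating_family E \<longrightarrow> |D| \<le>o |E| ))"

lemma dominating_number_minimal:
  obtains D where "dominating_family D" "dominating_number = |D|"
    "\<And>E. dominating_family E \<Longrightarrow> dominating_number \<le>o |E|"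
proof -
  let ?R = "{|D| | D. dominating_family D}"
  have "dominating_family UNIV"
    unfolding dominating_family_def
  proof
    show "\<exists>h\<in>UNIV. \<forall>\<^sub>F n in sequentially. g n \<le> h n" for g :: "nat \<Rightarrow> nat"
      by (rule bexI[of _ g]) auto
  qed
  then have "?R \<noteq> {}" by blast
  moreover have "\<forall>r\<in>?R. Card_order r" by (auto simp: card_of_Card_order)
  ultimately have "\<exists>r\<in>?R. \<forall>r'\<in>?R. r \<le>o r'"
    by (rule exists_minim_Card_order)
  then have "\<exists>r D. dominating_family D \<and> r = |D| \<and> (\<forall>E. dominating_family E \<longrightarrow> |D| \<le>o |E| )"
    by blast
  from someI_ex[OF this] show thesis
    using that unfolding dominating_number_def[symmetric] by auto
qed

text \<open>Principal ultrafilters are included.\<close>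

definition ultrafilter :: "'a set set \<Rightarrow> bool" where
  "ultrafilter U \<longleftrightarrow>
     UNIV \<in> U \<and> {} \<notin> U \<and>
     (\<forall>A B. A \<in> U \<longrightarrow> A \<subseteq> B \<longrightarrow> B \<in> U) \<and>
     (\<forall>A B. A \<in> U \<longrightarrow> B \<in> U \<longrightarrow> A \<inter> B \<in> U) \<and>
     (\<forall>A. A \<in> U \<or> - A \<in> U)"

definition finite_to_one :: "('a \<Rightarrow> 'b) \<Rightarrow> bool" where
  "finite_to_one g \<longleftrightarrow> (\<forall>y. finite (g -` {y}))"

definition Q_point :: "nat set set \<Rightarrow> bool" where
  "Q_point V \<longleftrightarrow>
     ultrafilter V \<and> (\<forall>g :: nat \<Rightarrow> nat. finite_to_one g \<longrightarrow> (\<exists>A\<in>V. inj_on g A))"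

definition RK_witness :: "(nat \<Rightarrow> nat) \<Rightarrow> nat set set \<Rightarrow> nat set set \<Rightarrow> bool" where
  "RK_witness f U V \<longleftrightarrow> U = {A. f -` A \<in> V}"

end

theory Submission
  imports Defs "HOL-Library.Countable_Set"
begin

text \<open>
  List a dominating family \<open>D\<close> of size \<open>\<aleph>\<^sub>1\<close> so that every initial segment is countable, and choose
  recursively for each \<open>h \<in> D\<close> a set \<open>X h\<close> whose elements \<open>a < b\<close> satisfy \<open>h a < b\<close>, such that finite
  intersections of these sets meet every fibre of \<open>f\<close> in an infinite set. At each stage only
  countably many infinite sets have to be met infinitely often, so a sparse set can be built one
  element at a time. Since all fibres are respected, the sets \<open>X h\<close>, the final segments of \<open>\<omega>\<close> and
  the preimages \<open>f\<^sup>-\<^sup>1(A)\<close> with \<open>A \<in> U\<close> together have the finite intersection property. Any ultrafilter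
  containing them is mapped to \<open>U\<close> by \<open>f\<close>, and it is a Q-point because \<open>X h\<close> is sparse enough to
  separate the fibres of \<open>g\<close>, up to finitely many points, once \<open>h\<close> dominates
  \<open>n \<mapsto> max g\<^sup>-\<^sup>1(g n)\<close>.
\<close>

section \<open>Ultrafilters from the finite intersection property\<close>

definition finite_intersection_property :: "'a set set \<Rightarrow> bool" where
  "finite_intersection_property B \<longleftrightarrow> (\<forall>F. finite F \<longrightarrow> F \<subseteq> B \<longrightarrow> \<Inter>F \<noteq> {})"

lemma finite_intersection_property_chain_Union:
  assumes "subset.chain {M. finite_intersection_property M} C" and "C \<noteq> {}"
  shows "finite_intersection_property (\<Union>C)"
  unfolding finite_intersection_property_def
proof (intro allI impI)
  fix F assume "finite F" "F \<subseteq> \<Union>C"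
  then obtain M where "M \<in> C" "F \<subseteq> M"
    using finite_subset_Union_chain[OF _ _ assms(2,1)] by blast
  then show "\<Inter>F \<noteq> {}"
    using assms(1) \<open>finite F\<close>
    by (auto simp: finite_intersection_property_def subset.chain_def subset_iff)
qed

text \<open>Any set meeting every finite intersection from \<open>M\<close> can be adjoined to
  \<open>M\<close> without losing the property, so by maximality it is already in \<open>M\<close>.
  All the closure conditions reduce to this.\<close>

lemma maximal_finite_intersection_property_ultrafilter:
  assumes fip: "finite_intersection_property M"
    and max: "\<And>N. finite_intersection_property N \<Longrightarrow> M \<subseteq> N \<Longrightarrow> N = M"
  shows "ultrafilter M"
proof -
  have mem: "A \<in> M" if "\<And>F. finite F \<Longrightarrow> F \<subseteq> M \<Longrightarrow> A \<inter> \<Inter>F \<noteq> {}" for A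
  proof -
    have "finite_intersection_property (insert A M)"
      unfolding finite_intersection_property_def
    proof (intro allI impI)
      fix F assume "finite F" "F \<subseteq> insert A M"
      then have "A \<inter> \<Inter>(F - {A}) \<noteq> {}" by (intro that) auto
      moreover have "A \<inter> \<Inter>(F - {A}) \<subseteq> \<Inter>F" by blast
      ultimately show "\<Inter>F \<noteq> {}" by blast
    qed
    then show ?thesis using max[of "insert A M"] by blast
  qed
  have ne: "\<Inter>F \<noteq> {}" if "finite F" "F \<subseteq> M" for F
    using fip that by (simp add: finite_intersection_property_def)
  have up: "B \<in> M" if "\<Inter>G \<subseteq> B" "finite G" "G \<subseteq> M" for B G
  proof (rule mem)
    fix F assume "finite F" "F \<subseteq> M"
    then have "\<Inter>(G \<union> F) \<noteq> {}" using that by (intro ne) auto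
    then show "B \<inter> \<Inter>F \<noteq> {}" using that by blast
  qed
  show ?thesis
    unfolding ultrafilter_def
  proof (intro conjI allI impI)
    show "UNIV \<in> M" by (rule up[of "{}"]) auto
    show "{} \<notin> M" using ne[of "{{}}"] by auto
    show "B \<in> M" if "A \<in> M" "A \<subseteq> B" for A B using up[of "{A}" B] that by auto
    show "A \<inter> B \<in> M" if "A \<in> M" "B \<in> M" for A B using up[of "{A, B}"] that by auto
    show "A \<in> M \<or> - A \<in> M" for A
    proof (rule disjCI)
      assume "- A \<notin> M"
      then obtain G where "finite G" "G \<subseteq> M" "- A \<inter> \<Inter>G = {}" using mem[of "- A"] by metis
      then show "A \<in> M" by (intro up[of G]) auto
    qed
  qed
qed

lemma ultrafilter_extension:
  assumes "finite_intersection_property B"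
  obtains V where "ultrafilter V" "B \<subseteq> V"
proof -
  let ?S = "{M. finite_intersection_property M \<and> B \<subseteq> M}"
  have "\<exists>M\<in>?S. \<forall>N\<in>?S. M \<subseteq> N \<longrightarrow> N = M"
  proof (rule subset_Zorn_nonempty)
    show "?S \<noteq> {}" using assms by blast
    fix C assume "C \<noteq> {}" and chain: "subset.chain ?S C"
    have "subset.chain {M. finite_intersection_property M} C"
      using chain by (auto simp: subset.chain_def)
    then have "finite_intersection_property (\<Union>C)"
      using \<open>C \<noteq> {}\<close> by (rule finite_intersection_property_chain_Union)
    moreover have "C \<subseteq> ?S" using chain by (simp add: subset.chain_def)
    ultimately show "\<Union>C \<in> ?S" using \<open>C \<noteq> {}\<close> by blast
  qed
  then obtain M where "M \<in> ?S" and max: "\<forall>N\<in>?S. M \<subseteq> N \<longrightarrow> N = M" by (rule bexE)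
  then have M: "finite_intersection_property M" "B \<subseteq> M" by simp_all
  from M(1) have "ultrafilter M"
  proof (rule maximal_finite_intersection_property_ultrafilter)
    \<comment> \<open>Maximality among families containing \<open>B\<close> suffices, since every
      \<open>N\<close> above \<open>M\<close> contains \<open>B\<close>.\<close>
    show "N = M" if "finite_intersection_property N" "M \<subseteq> N" for N
      using max that M(2) by simp
  qed
  with M(2) show thesis by (rule that[rotated])
qed

text \<open>The reverse inclusion is automatic: if \<open>A\<close> is not in \<open>U\<close>, its
  complement is, and \<open>V\<close> cannot contain two disjoint preimages.\<close>

lemma RK_witnessI:
  assumes U: "ultrafilter U" and V: "ultrafilter V" and vimage: "\<And>A. A \<in> U \<Longrightarrow> f -` A \<in> V"
  shows "RK_witness f U V"
proof -
  have "A \<in> U" if "f -` A \<in> V" for A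
  proof (rule ccontr)
    assume "A \<notin> U"
    then have "f -` (- A) \<in> V" using U vimage by (auto simp: ultrafilter_def)
    then have "f -` A \<inter> f -` (- A) \<in> V" using V that by (auto simp: ultrafilter_def)
    moreover have "f -` A \<inter> f -` (- A) = {}" by auto
    ultimately show False using V by (simp add: ultrafilter_def)
  qed
  then show ?thesis using vimage by (auto simp: RK_witness_def)
qed

section \<open>Sparse sets and their transfinite construction\<close>

definition sparse :: "(nat \<Rightarrow> nat) \<Rightarrow> nat set \<Rightarrow> bool" where
  "sparse h X \<longleftrightarrow> (\<forall>a\<in>X. \<forall>b\<in>X. a < b \<longrightarrow> h a < b)"

lemma sparse_set_meeting_countable_family:
  assumes "countable \<A>" and inf: "\<And>A. A \<in> \<A> \<Longrightarrow> infinite A"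
  obtains Y where "sparse h Y" "\<And>A. A \<in> \<A> \<Longrightarrow> infinite (Y \<inter> A)"
proof (cases "\<A> = {}")
  case True
  show ?thesis by (rule that[of "{}"]) (auto simp: sparse_def True)
next
  case False
  \<comment> \<open>every member of \<open>\<A>\<close> occurs infinitely often as a value of \<open>e\<close>\<close>
  define e where "e i = from_nat_into \<A> (fst (prod_decode i))" for i
  have e: "infinite (e i)" for i
    unfolding e_def by (intro inf from_nat_into False)
  have "\<exists>s. \<forall>i. s i \<in> e i \<and> (\<forall>j<i. s j < s i \<and> h (s j) < s i)"
  proof (rule dependent_wf_choice[where R = less_than, simplified])
    fix i and s :: "nat \<Rightarrow> nat"
    \<comment> \<open>The sum bounds all earlier elements and their \<open>h\<close>-values, so any
      larger element of \<open>e i\<close> may be chosen next.\<close>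
    define m where "m = (\<Sum>j<i. s j + h (s j))"
    obtain r where "r \<in> e i" "m < r" using e[of i] by (auto simp: infinite_nat_iff_unbounded)
    moreover have "s j + h (s j) \<le> m" if "j < i" for j
      unfolding m_def using that by (intro member_le_sum) auto
    ultimately show "\<exists>r. r \<in> e i \<and> (\<forall>j<i. s j < r \<and> h (s j) < r)"
      by (intro exI[of _ r]) force
  qed auto
  then obtain s where s: "\<And>i. s i \<in> e i" and step: "\<And>i j. j < i \<Longrightarrow> s j < s i \<and> h (s j) < s i"
    by blast
  have mono: "strict_mono s" using step by (simp add: strict_mono_def)
  show ?thesis
  proof (rule that)
    show "sparse h (range s)"
      using step by (auto simp: sparse_def strict_mono_less[OF mono])
    fix A assume "A \<in> \<A>"
    then obtain k where k: "from_nat_into \<A> k = A"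
      using from_nat_into_surj[OF \<open>countable \<A>\<close>] by blast
    \<comment> \<open>These are the stages devoted to \<open>A\<close>; as \<open>s\<close> is
      injective, they contribute infinitely many elements.\<close>
    let ?t = "\<lambda>i. s (prod_encode (k, i))"
    have "range ?t \<subseteq> range s \<inter> A"
      using s[of "prod_encode (k, _)"] by (auto simp: e_def k)
    moreover have "infinite (range ?t)"
      by (rule range_inj_infinite)
        (auto intro!: injI dest!: injD[OF strict_mono_imp_inj_on[OF mono]])
    ultimately show "infinite (range s \<inter> A)" by (rule infinite_super)
  qed
qed

text \<open>Isolates the index that a recursion along \<open>r\<close> treats last: the remaining
  ones are all strict predecessors of it.\<close>

lemma finite_Linear_order_max:
  assumes "finite S" "S \<noteq> {}" "S \<subseteq> Field r" "Linear_order r"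
  obtains m where "m \<in> S" "S - {m} \<subseteq> underS r m"
proof -
  have "\<exists>m\<in>S. \<forall>x\<in>S. (x, m) \<in> r"
    using assms(1-3)
  proof (induction S rule: finite_ne_induct)
    case (singleton x)
    then show ?case
      using assms(4) by (auto simp: order_on_defs refl_on_def)
  next
    case (insert x S)
    then obtain m where m: "m \<in> S" "\<forall>y\<in>S. (y, m) \<in> r" by auto
    have field: "x \<in> Field r" "m \<in> Field r" using insert.prems m(1) by auto
    have refl: "(x, x) \<in> r"
      using assms(4) field by (auto simp: order_on_defs refl_on_def)
    have "total_on (Field r) r" using assms(4) by (simp add: order_on_defs)
    with field refl have total: "(x, m) \<in> r \<or> (m, x) \<in> r"
      unfolding total_on_def by metis
    have trans: "trans r" using assms(4) by (simp add: order_on_defs)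
    from total show ?case
    proof
      assume "(x, m) \<in> r"
      with m show ?thesis by blast
    next
      assume "(m, x) \<in> r"
      with m(2) trans have "\<forall>y\<in>S. (y, x) \<in> r" by (meson transD)
      with refl show ?thesis by blast
    qed
  qed
  then show thesis using that by (auto simp: underS_def)
qed

text \<open>Proper initial segments of a cardinal order have strictly smaller cardinality, and below
  \<aleph>_1 this means countable. This is the use made of \<dd> = \<aleph>_1.\<close>

lemma countable_underS:
  assumes "Card_order r" and r: "r =o cardSuc natLeq"
  shows "countable (underS r a)"
proof (cases "a \<in> Field r")
  case True
  with assms(1) have "|underS r a| <o r" by (rule card_of_underS)
  then have "|underS r a| <o cardSuc natLeq"
    using r by (rule ordLess_ordIso_trans)
  then have "|underS r a| \<le>o natLeq"
    by (simp only: cardSuc_ordLeq_ordLess[OF natLeq_Card_order card_of_Card_order])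
  then have "|underS r a| \<le>o |UNIV :: nat set|"
    by (rule ordLeq_ordIso_trans) (rule ordIso_symmetric[OF card_of_nat])
  then show ?thesis
    by (auto simp: countable_def card_of_ordLeq[symmetric])
next
  case False
  then have "underS r a = {}" using FieldI2 by (fastforce simp: underS_def)
  then show ?thesis by simp
qed

lemma sparse_family:
  fixes f :: "nat \<Rightarrow> nat"
  assumes D: "|D| =o cardSuc natLeq" and f: "\<And>n. infinite (f -` {n})"
  obtains X where "\<And>h. h \<in> D \<Longrightarrow> sparse h (X h)"
    "\<And>S n. finite S \<Longrightarrow> S \<subseteq> D \<Longrightarrow> infinite ((\<Inter>h\<in>S. X h) \<inter> f -` {n})"
proof -
  let ?r = "|D|"
  \<comment> \<open>The demand on stage \<open>h\<close> mentions \<open>X\<close> only at strict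
    predecessors of \<open>h\<close>, as well-founded recursion requires.\<close>
  let ?P = "\<lambda>X h Y. sparse h Y \<and>
    (\<forall>S n. finite S \<longrightarrow> S \<subseteq> underS ?r h \<longrightarrow> infinite (Y \<inter> ((\<Inter>i\<in>S. X i) \<inter> f -` {n})))"
  have wo: "Well_order ?r" by (rule card_of_Well_order)
  have lin: "Linear_order ?r" using wo by (simp add: well_order_on_def)
  \<comment> \<open>The demand at the last index of \<open>S\<close> already covers the other
    indices. Assuming \<open>?P\<close> only on \<open>S\<close> lets this serve both during the
    recursion and after it.\<close>
  have inter: "infinite ((\<Inter>i\<in>S. X i) \<inter> f -` {n})"
    if S: "finite S" "S \<subseteq> D" and P: "\<And>i. i \<in> S \<Longrightarrow> ?P X i (X i)" for X S n
  proof (cases "S = {}")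
    case True
    then show ?thesis using f by simp
  next
    case False
    then obtain m where m: "m \<in> S" "S - {m} \<subseteq> underS ?r m"
      using finite_Linear_order_max[OF S(1) _ _ lin] S(2) Field_card_of[of D] by metis
    then have "infinite (X m \<inter> ((\<Inter>i\<in>S - {m}. X i) \<inter> f -` {n}))"
      using P[OF m(1)] S(1) by blast
    moreover have "X m \<inter> ((\<Inter>i\<in>S - {m}. X i) \<inter> f -` {n}) \<subseteq> (\<Inter>i\<in>S. X i) \<inter> f -` {n}"
      by auto
    ultimately show ?thesis by (rule infinite_super[rotated])
  qed
  \<comment> \<open>The recursion runs over all functions; those outside \<open>D\<close> have no
    predecessors and do no harm.\<close>
  have "\<exists>X. \<forall>h. ?P X h (X h)"
  proof (rule dependent_wf_choice)
    show "wf (?r - Id)" using wo by (simp add: well_order_on_def)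
    show "?P X h Y = ?P Z h Y" if eq: "\<And>i. (i, h) \<in> ?r - Id \<Longrightarrow> X i = Z i" for X Z h Y
    proof -
      have "(\<Inter>i\<in>S. X i) = (\<Inter>i\<in>S. Z i)" if "S \<subseteq> underS ?r h" for S
        using that eq by (intro INF_cong) (auto simp: underS_def)
      then show ?thesis by simp
    qed
    show "\<exists>Y. ?P X h Y" if P: "\<And>i. (i, h) \<in> ?r - Id \<Longrightarrow> ?P X i (X i)" for X h
    proof -
      \<comment> \<open>These are the sets that stage \<open>h\<close> must meet infinitely often;
        they are countably many because \<open>h\<close> has countably many predecessors.\<close>
      let ?A = "(\<lambda>(S, n). (\<Inter>i\<in>S. X i) \<inter> f -` {n}) `
        ({S. finite S \<and> S \<subseteq> underS ?r h} \<times> UNIV)"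
      have sub: "underS ?r h \<subseteq> D"
        using Field_card_of[of D] by (auto simp: underS_def intro: FieldI1)
      have "countable ?A"
        by (intro countable_image countable_SIGMA countable_Collect_finite_subset
            countable_underS card_of_Card_order D) auto
      moreover have "infinite A" if A: "A \<in> ?A" for A
      proof -
        obtain S n where S: "finite S" "S \<subseteq> underS ?r h" and A: "A = (\<Inter>i\<in>S. X i) \<inter> f -` {n}"
          using A by auto
        have "?P X i (X i)" if "i \<in> S" for i
          using that S(2) by (intro P) (auto simp: underS_def)
        then show ?thesis
          unfolding A using S sub by (intro inter) auto
      qed
      ultimately obtain Y where "sparse h Y" and "\<And>A. A \<in> ?A \<Longrightarrow> infinite (Y \<inter> A)"
        using sparse_set_meeting_countable_family[of ?A h] by blast
      then show ?thesis by (intro exI[of _ Y]) auto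
    qed
  qed
  then obtain X where X: "\<And>h. ?P X h (X h)" by blast
  show thesis
  proof (rule that)
    show "sparse h (X h)" for h using X[of h] by (rule conjunct1)
    show "infinite ((\<Inter>h\<in>S. X h) \<inter> f -` {n})" if "finite S" "S \<subseteq> D" for S n
      using that X by (rule inter)
  qed
qed

section \<open>From sparse sets to a Q-point above \<open>U\<close>\<close>

lemma sparse_inj_on:
  assumes g: "finite_to_one g" and h: "\<And>n. N \<le> n \<Longrightarrow> Max (g -` {g n}) \<le> h n"
    and X: "sparse h X"
  shows "inj_on g (X \<inter> {N..})"
proof (rule linorder_inj_onI)
  fix a b assume ab: "a < b" "a \<in> X \<inter> {N..}" "b \<in> X \<inter> {N..}"
  show "g a \<noteq> g b"
  proof
    assume "g a = g b"
    \<comment> \<open>Finite fibres make \<open>Max\<close> meaningful, and \<open>a\<close> lies in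
      the tail where \<open>h\<close> bounds it, so sparseness puts \<open>b\<close> beyond its own
      fibre.\<close>
    then have "b \<le> Max (g -` {g a})"
      using g by (intro Max_ge) (auto simp: finite_to_one_def)
    also have "\<dots> \<le> h a" using h ab by simp
    also have "\<dots> < b" using X ab by (simp add: sparse_def)
    finally show False by simp
  qed
qed auto

lemma ultrafilter_finite_Inter:
  assumes "ultrafilter U" "finite F" "F \<subseteq> U"
  shows "\<Inter>F \<in> U"
  using assms(2,3)
  by (induction F rule: finite_induct) (use assms(1) in \<open>auto simp: ultrafilter_def\<close>)

lemma vimage_finite_intersection_property:
  assumes U: "ultrafilter U"
    and X: "\<And>S n. finite S \<Longrightarrow> S \<subseteq> D \<Longrightarrow> infinite ((\<Inter>h\<in>S. X h) \<inter> f -` {n})"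
  shows "finite_intersection_property (X ` D \<union> (range atLeast :: nat set set) \<union> (-`) f ` U)"
  unfolding finite_intersection_property_def
proof (intro allI impI)
  fix F assume "finite F" and F: "F \<subseteq> X ` D \<union> range atLeast \<union> (-`) f ` U"
  obtain S where S: "S \<subseteq> D" "finite S" "F \<inter> X ` D = X ` S"
    using finite_subset_image[of "F \<inter> X ` D" X D] \<open>finite F\<close> by auto
  obtain T :: "nat set" where T: "finite T" "F \<inter> range atLeast = atLeast ` T"
    using finite_subset_image[of "F \<inter> range atLeast" atLeast UNIV] \<open>finite F\<close> by auto
  obtain G where G: "G \<subseteq> U" "finite G" "F \<inter> (-`) f ` U = (-`) f ` G"
    using finite_subset_image[of "F \<inter> (-`) f ` U" "(-`) f" U] \<open>finite F\<close> by auto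
  have "\<Inter>G \<in> U" using ultrafilter_finite_Inter[OF U G(2,1)] .
  moreover have "{} \<notin> U" using U by (simp add: ultrafilter_def)
  \<comment> \<open>The whole fibre over this \<open>n\<close> lies in every preimage occurring in
    \<open>F\<close>, so it remains to find a large point of it in the sparse sets.\<close>
  ultimately obtain n where n: "n \<in> \<Inter>G" by (metis all_not_in_conv)
  \<comment> \<open>Inserting 0 keeps \<open>Max\<close> defined when no tails occur in
    \<open>F\<close>.\<close>
  obtain x where x: "x \<in> (\<Inter>h\<in>S. X h) \<inter> f -` {n}" "Max (insert 0 T) \<le> x"
    using X[OF S(2,1), of n] by (auto simp: infinite_nat_iff_unbounded_le)
  have "x \<in> A" if "A \<in> F" for A
  proof -
    have "A \<in> F \<inter> X ` D \<or> A \<in> F \<inter> range atLeast \<or> A \<in> F \<inter> (-`) f ` U"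
      using that F by blast
    then have "A \<in> X ` S \<or> A \<in> atLeast ` T \<or> A \<in> (-`) f ` G"
      by (simp only: S(3) T(2) G(3))
    then show ?thesis using x n T(1) by auto
  qed
  then show "\<Inter>F \<noteq> {}" by blast
qed

theorem theorem2p4:
  fixes U :: "nat set set" and f :: "nat \<Rightarrow> nat"
  assumes "dominating_number =o cardSuc natLeq"
    and "ultrafilter U"
    and "\<And>n. |f -` {n}| =o natLeq"
  shows "\<exists>V. ultrafilter V \<and> Q_point V \<and> RK_witness f U V"
proof -
  obtain D where dom: "dominating_family D" and "dominating_number = |D|"
    using dominating_number_minimal by blast
  with assms(1) have D: "|D| =o cardSuc natLeq" by simp
  have fib: "infinite (f -` {n})" for n
    using assms(3)[of n] by (auto simp: finite_iff_ordLess_natLeq dest: not_ordLess_ordIso)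
  obtain X where sparse: "\<And>h. h \<in> D \<Longrightarrow> sparse h (X h)"
    and X: "\<And>S n. finite S \<Longrightarrow> S \<subseteq> D \<Longrightarrow> infinite ((\<Inter>h\<in>S. X h) \<inter> f -` {n})"
    using sparse_family[OF D fib] by blast
  from assms(2) X
  have "finite_intersection_property (X ` D \<union> range atLeast \<union> (-`) f ` U)"
    by (rule vimage_finite_intersection_property)
  then obtain V where V: "ultrafilter V"
    and sub: "X ` D \<union> range atLeast \<union> (-`) f ` U \<subseteq> V"
    by (rule ultrafilter_extension)
  have "\<exists>A\<in>V. inj_on g A" if g: "finite_to_one g" for g :: "nat \<Rightarrow> nat"
  proof -
    obtain h N where h: "h \<in> D" "\<And>n. N \<le> n \<Longrightarrow> Max (g -` {g n}) \<le> h n"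
      using dom[unfolded dominating_family_def, rule_format, of "\<lambda>n. Max (g -` {g n})"]
      by (auto simp: eventually_sequentially)
    \<comment> \<open>The tail removes the finitely many points at which \<open>h\<close> may fail
      to dominate.\<close>
    have "X h \<in> V" "{N..} \<in> V" using sub h(1) by auto
    then have "X h \<inter> {N..} \<in> V" using V by (simp add: ultrafilter_def)
    with sparse_inj_on[OF g h(2) sparse[OF h(1)]] show ?thesis by blast
  qed
  with V have "Q_point V" by (simp add: Q_point_def)
  moreover have "RK_witness f U V" using assms(2) V by (rule RK_witnessI) (use sub in auto)
  ultimately show ?thesis using V by blast
qed

end
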